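(* Let $\mathsf X,\mathsf Y$ be Banach spaces, $T>0$, $X\subset\mathsf X$ open and connected, and let $f\in C^2(X\times(0,T);\mathsf Y)$ be such that $f(\cdot,t):X\to\mathsf Y$ is a Fredholm map of index $0$ for every $t\in(0,T)$. Let $\Sigma:=X\times(0,T)\times(\mathsf X\setminus\{0\})$ and let $$g:\Sigma\to\mathsf Y\times\mathsf Y,\qquad g(x,t,v):=\big(f(x,t),\,D_xf(x,t)[v]\big).$$ Then $f$ satisfies the transversality conditions (i.e. (T1), (T2), (T3) hold at every point of its singular set $\mathcal S$) if and only if $(0,0)$ is a regular value of $g$.
   Context: A bounded linear operator $L\in\mathcal L(\mathsf X;\mathsf Y)$ is Fredholm if $\dim\mathsf N(L)$ and $\operatorname{codim}\mathsf R(L)$ are finite ($\mathsf N$ = kernel, $\mathsf R$ = range); its index is $\dim\mathsf N(L)-\operatorname{codim}\mathsf R(L)$. A $C^1$ map on a connected open set is a Fredholm map of index $k$ if its differential at every point is a Fredholm operator (of index $k$). $L^*\in\mathcal L(\mathsf Y^*;\mathsf X^* )$ is the adjoint of $L$. $D_xf$, $D_x^2f$ are the partial differentials with respect to $x\in\mathsf X$, and $\partial_tf$ is the partial derivative in $t$. $(0,0)$ is a regular value of $g$ if the total differential $\mathrm dg$ is surjective at each point of $g^{-1}(0,0)$. Define $\mathcal S:=\{(x,t)\in X\times(0,T): f(x,t)=0,\ D_xf(x,t)\text{ is not invertible}\}$. Transversality conditions at a point $(x_0,t_0)\in\mathcal S$: (T1) $\dim\mathsf N(D_xf(x_0,t_0))=1$;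 (T2) if $0\neq\ell^*\in\mathsf N(D_xf(x_0,t_0)^* )$, then ${}_{\mathsf Y^*}\langle\ell^*,\partial_tf(x_0,t_0)\rangle_{\mathsf Y}\neq0$; (T3) if $0\neq v\in\mathsf N(D_xf(x_0,t_0))$ and $0\neq\ell^*\in\mathsf N(D_xf(x_0,t_0)^* )$, then ${}_{\mathsf Y^*}\langle\ell^*,D_x^2f(x_0,t_0)[v,v]\rangle_{\mathsf Y}\neq0$. $f$ satisfies the transversality conditions if they hold at every point of $\mathcal S$. *)

theory Defs
  imports "HOL-Analysis.Analysis"
begin

subsection \<open>Finite dimension and codimension\<close>

definition finite_dim :: "'a::real_vector set \<Rightarrow> bool" where
  "finite_dim V \<longleftrightarrow> (\<exists>B. finite B \<and> span B = V)"

definition algebraic_complement :: "'a::real_vector set \<Rightarrow> 'a set \<Rightarrow> bool" where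
  "algebraic_complement W C \<longleftrightarrow>
     subspace C \<and> W \<inter> C = {0} \<and> (\<forall>y. \<exists>w\<in>W. \<exists>c\<in>C. y = w + c)"

definition finite_codim :: "'a::real_vector set \<Rightarrow> bool" where
  "finite_codim W \<longleftrightarrow> (\<exists>C. algebraic_complement W C \<and> finite_dim C)"

text \<open>
  The choice of the complement is immaterial, see \<open>codim_eq_dim_complement\<close> below.
  As \<^term>\<open>dim\<close> is 0 on infinite-dimensional spaces, \<open>codim\<close> is meaningful only
  under \<^term>\<open>finite_codim\<close>.
\<close>
definition codim :: "'a::real_vector set \<Rightarrow> nat" where
  "codim W = dim (SOME C. algebraic_complement W C)"

lemma complement_dim_transfer:
  fixes W :: "'a::real_vector set"
  assumes W: "subspace W" and C: "algebraic_complement W C" and D: "algebraic_complement W D"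
    and fin: "finite_dim C"
  shows "dim D = dim C"
proof -
  have sC: "subspace C" and sD: "subspace D" and WC: "W \<inter> C = {0}" and WD: "W \<inter> D = {0}"
    using C D by (auto simp: algebraic_complement_def)
  have "\<exists>p. \<forall>y. p y \<in> D \<and> y - p y \<in> W"
  proof (intro choice allI)
    fix y
    obtain w d where "w \<in> W" "d \<in> D" "y = w + d"
      using D unfolding algebraic_complement_def by blast
    then show "\<exists>d. d \<in> D \<and> y - d \<in> W" by (intro exI[of _ d]) simp
  qed
  then obtain p where p: "\<And>y. p y \<in> D" "\<And>y. y - p y \<in> W" by blast
  have uniq: "p y = d" if "d \<in> D" "y - d \<in> W" for y d
  proof -
    have "p y - d \<in> D" using p(1) that(1) sD by (simp add: subspace_diff)
    moreover have "(y - d) - (y - p y) \<in> W" by (rule subspace_diff[OF W that(2) p(2)])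
    ultimately have "p y - d \<in> W \<inter> D" by simp
    then show ?thesis using WD by simp
  qed
  have lin: "linear p"
  proof (rule linearI)
    fix a b
    have "(a - p a) + (b - p b) \<in> W" using p(2) W by (intro subspace_add)
    then have "(a + b) - (p a + p b) \<in> W" by (simp add: algebra_simps)
    then show "p (a + b) = p a + p b" using p(1) sD by (intro uniq subspace_add)
  next
    fix r b
    have "r *\<^sub>R (b - p b) \<in> W" using p(2) W by (intro subspace_scale)
    then have "r *\<^sub>R b - r *\<^sub>R p b \<in> W" by (simp add: algebra_simps)
    then show "p (r *\<^sub>R b) = r *\<^sub>R p b" using p(1) sD by (intro uniq subspace_scale)
  qed
  have inj: "inj_on p C"
  proof (rule inj_onI)
    fix a b assume ab: "a \<in> C" "b \<in> C" "p a = p b"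
    have "(a - p a) - (b - p b) \<in> W" by (rule subspace_diff[OF W p(2) p(2)])
    then have "a - b \<in> W" using ab(3) by simp
    moreover have "a - b \<in> C" using ab sC by (intro subspace_diff)
    ultimately have "a - b \<in> W \<inter> C" by simp
    then show "a = b" using WC by simp
  qed
  have img: "p ` C = D"
  proof
    show "p ` C \<subseteq> D" using p(1) by blast
    show "D \<subseteq> p ` C"
    proof
      fix d assume d: "d \<in> D"
      obtain w c where wc: "w \<in> W" "c \<in> C" "d = w + c"
        using C unfolding algebraic_complement_def by blast
      then have "c - d \<in> W" using W subspace_neg[of W w] by simp
      then have "p c = d" using d by (intro uniq)
      then show "d \<in> p ` C" using wc(2) by blast
    qed
  qed
  obtain B where B: "B \<subseteq> C" "independent B" "C \<subseteq> span B" "card B = dim C"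
    using basis_exists by blast
  have spB: "span B = C" using B sC by (metis span_minimal subset_antisym)
  have "independent (p ` B)"
    using lin B(2) inj spB by (intro linear_independent_injective_image) auto
  moreover have "span (p ` B) = D" using img spB lin by (simp add: linear_span_image)
  moreover have "card (p ` B) = card B" using inj B(1) by (meson card_image inj_on_subset)
  ultimately show ?thesis using B(4) by (metis dim_span_eq_card_independent)
qed

lemma codim_eq_dim_complement:
  assumes "subspace W" "algebraic_complement W C" "finite_dim C"
  shows "codim W = dim C"
  unfolding codim_def
  by (rule complement_dim_transfer[OF assms(1,2) someI[of "algebraic_complement W", OF assms(2)] assms(3)])

subsection \<open>Bounded operators between normed spaces\<close>

definition null_space :: "('a::real_normed_vector \<Rightarrow>\<^sub>L 'b::real_normed_vector) \<Rightarrow> 'a set" where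
  "null_space L = {x. blinfun_apply L x = 0}"

definition range_space :: "('a::real_normed_vector \<Rightarrow>\<^sub>L 'b::real_normed_vector) \<Rightarrow> 'b set" where
  "range_space L = range (blinfun_apply L)"

definition invertible_op :: "('a::real_normed_vector \<Rightarrow>\<^sub>L 'b::real_normed_vector) \<Rightarrow> bool" where
  "invertible_op L \<longleftrightarrow> (\<exists>M. M o\<^sub>L L = id_blinfun \<and> L o\<^sub>L M = id_blinfun)"

lift_definition adjoint_op ::
  "('a::real_normed_vector \<Rightarrow>\<^sub>L 'b::real_normed_vector) \<Rightarrow> ('b \<Rightarrow>\<^sub>L real) \<Rightarrow>\<^sub>L ('a \<Rightarrow>\<^sub>L real)"
  is "\<lambda>L l. l o\<^sub>L L"
  by (rule bounded_bilinear.bounded_linear_left[OF bounded_bilinear_blinfun_compose])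

definition fredholm_op :: "('a::real_normed_vector \<Rightarrow>\<^sub>L 'b::real_normed_vector) \<Rightarrow> bool" where
  "fredholm_op L \<longleftrightarrow> finite_dim (null_space L) \<and> finite_codim (range_space L)"

definition fredholm_index :: "('a::real_normed_vector \<Rightarrow>\<^sub>L 'b::real_normed_vector) \<Rightarrow> int" where
  "fredholm_index L = int (dim (null_space L)) - int (codim (range_space L))"

subsection \<open>Differentials\<close>

text \<open>The differential as an element of the normed space of bounded operators; meaningful only
  where the map is differentiable.\<close>
definition differential ::
  "('a::real_normed_vector \<Rightarrow> 'b::real_normed_vector) \<Rightarrow> 'a \<Rightarrow> 'a \<Rightarrow>\<^sub>L 'b" where
  "differential F x = Blinfun (frechet_derivative F (at x))"

lemma differential_eq:
  assumes "(F has_derivative blinfun_apply L) (at x)"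
  shows "differential F x = L"
  by (simp add: differential_def frechet_derivative_at[OF assms, symmetric] blinfun_apply_inverse)

definition C1_on :: "'a::real_normed_vector set \<Rightarrow> ('a \<Rightarrow> 'b::real_normed_vector) \<Rightarrow> bool" where
  "C1_on U F \<longleftrightarrow> open U \<and> (\<forall>x\<in>U. F differentiable (at x)) \<and> continuous_on U (differential F)"

definition C2_on :: "'a::real_normed_vector set \<Rightarrow> ('a \<Rightarrow> 'b::real_normed_vector) \<Rightarrow> bool" where
  "C2_on U F \<longleftrightarrow> C1_on U F \<and> C1_on U (differential F)"

definition fredholm_map ::
  "int \<Rightarrow> 'a::real_normed_vector set \<Rightarrow> ('a \<Rightarrow> 'b::real_normed_vector) \<Rightarrow> bool" where
  "fredholm_map k U F \<longleftrightarrow>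
     open U \<and> connected U \<and> C1_on U F \<and>
     (\<forall>x\<in>U. fredholm_op (differential F x) \<and> fredholm_index (differential F x) = k)"

definition regular_value_on ::
  "'a::real_normed_vector set \<Rightarrow> ('a \<Rightarrow> 'b::real_normed_vector) \<Rightarrow> 'b \<Rightarrow> bool" where
  "regular_value_on U F y \<longleftrightarrow> (\<forall>p\<in>U. F p = y \<longrightarrow> surj (blinfun_apply (differential F p)))"

definition Dx :: "('a::real_normed_vector \<times> real \<Rightarrow> 'b::real_normed_vector) \<Rightarrow> 'a \<Rightarrow> real \<Rightarrow> 'a \<Rightarrow>\<^sub>L 'b"
  where "Dx f x t = differential (\<lambda>x. f (x, t)) x"

definition Dxx ::
  "('a::real_normed_vector \<times> real \<Rightarrow> 'b::real_normed_vector) \<Rightarrow> 'a \<Rightarrow> real \<Rightarrow> 'a \<Rightarrow>\<^sub>L 'a \<Rightarrow>\<^sub>L 'b"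
  where "Dxx f x t = differential (\<lambda>x. Dx f x t) x"

definition Dt :: "('a::real_normed_vector \<times> real \<Rightarrow> 'b::real_normed_vector) \<Rightarrow> 'a \<Rightarrow> real \<Rightarrow> 'b"
  where "Dt f x t = vector_derivative (\<lambda>t. f (x, t)) (at t)"

subsection \<open>The singular set and the transversality conditions\<close>

definition singular_set ::
  "'a::real_normed_vector set \<Rightarrow> real \<Rightarrow> ('a \<times> real \<Rightarrow> 'b::real_normed_vector) \<Rightarrow> ('a \<times> real) set" where
  "singular_set X T f =
     {(x, t). x \<in> X \<and> t \<in> {0<..<T} \<and> f (x, t) = 0 \<and> \<not> invertible_op (Dx f x t)}"

definition T1_cond ::
  "('a::real_normed_vector \<times> real \<Rightarrow> 'b::real_normed_vector) \<Rightarrow> 'a \<Rightarrow> real \<Rightarrow> bool" where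
  "T1_cond f x t \<longleftrightarrow> dim (null_space (Dx f x t)) = 1"

definition T2_cond ::
  "('a::real_normed_vector \<times> real \<Rightarrow> 'b::real_normed_vector) \<Rightarrow> 'a \<Rightarrow> real \<Rightarrow> bool" where
  "T2_cond f x t \<longleftrightarrow>
     (\<forall>l. l \<noteq> 0 \<and> l \<in> null_space (adjoint_op (Dx f x t)) \<longrightarrow> blinfun_apply l (Dt f x t) \<noteq> 0)"

definition T3_cond ::
  "('a::real_normed_vector \<times> real \<Rightarrow> 'b::real_normed_vector) \<Rightarrow> 'a \<Rightarrow> real \<Rightarrow> bool" where
  "T3_cond f x t \<longleftrightarrow>
     (\<forall>v l. v \<noteq> 0 \<and> v \<in> null_space (Dx f x t) \<and>
            l \<noteq> 0 \<and> l \<in> null_space (adjoint_op (Dx f x t)) \<longrightarrow>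
            blinfun_apply l (blinfun_apply (blinfun_apply (Dxx f x t) v) v) \<noteq> 0)"

definition transversality_conditions ::
  "'a::real_normed_vector set \<Rightarrow> real \<Rightarrow> ('a \<times> real \<Rightarrow> 'b::real_normed_vector) \<Rightarrow> bool" where
  "transversality_conditions X T f \<longleftrightarrow>
     (\<forall>(x, t)\<in>singular_set X T f. T1_cond f x t \<and> T2_cond f x t \<and> T3_cond f x t)"

end

theory Submission
  imports Defs
begin

text \<open>
  The differential of \<open>g\<close> at \<open>(x, t, v)\<close> maps \<open>(\<xi>, \<tau>, w)\<close> to \<open>(L \<xi> + \<tau> b, A (\<xi>, \<tau>) + L w)\<close> with
  \<open>L = D\<^sub>x f(x,t)\<close>, \<open>b = \<partial>\<^sub>t f(x,t)\<close> and \<open>A (\<xi>, \<tau>) = D(D\<^sub>x f)(x,t)[\<xi>, \<tau>] v\<close>. As \<open>L\<close> has index 0, surjectivity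
  of the first component says that \<open>L\<close> has a one-dimensional kernel and that \<open>b\<close> is not in
  the range of \<open>L\<close>; given this, \<open>(0, z)\<close> is only reached with \<open>\<tau> = 0\<close> and \<open>\<xi>\<close> a multiple of \<open>v\<close>, so
  surjectivity of the second component says that \<open>A (v, 0)\<close> is not in the range of \<open>L\<close> either.
  The open mapping theorem makes the range of \<open>L\<close> the kernel of a bounded functional.
\<close>

subsection \<open>The open mapping theorem\<close>

text \<open>By Baire in the complete space \<open>'b\<close>, some closure of the image of a ball
  has an interior point. Subtracting approximate preimages of two nearby points removes the unknown
  centre, and scaling gives the bound for every \<open>z\<close>.\<close>

lemma surj_imp_almost_open:
  fixes L :: "'a::real_normed_vector \<Rightarrow>\<^sub>L 'b::banach"
  assumes "surj L"
  obtains M where "M > 0" "\<And>z. \<exists>x. norm x \<le> M * norm z \<and> norm (z - L x) \<le> norm z / 2"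
proof -
  define C where "C n = closure (L ` ball 0 (real n))" for n
  have "\<exists>n. interior (C n) \<noteq> {}"
  proof (rule ccontr)
    assume "\<not> ?thesis"
    then have "euclidean interior_of (\<Union>(range C)) = {}"
      by (intro Baire_category_alt) (auto simp: completely_metrizable_space_euclidean C_def)
    moreover have "y \<in> \<Union>(range C)" for y
    proof -
      obtain x where x: "y = L x" using assms by (metis surj_def)
      obtain n where "norm x < real n" using reals_Archimedean2 by blast
      then have "y \<in> C n" using x closure_subset by (fastforce simp: C_def)
      then show ?thesis by blast
    qed
    then have "\<Union>(range C) = UNIV" by blast
    ultimately show False by simp
  qed
  then obtain n y0 where "y0 \<in> interior (C n)" by blast
  then obtain r where r: "r > 0" "ball y0 r \<subseteq> C n" by (meson mem_interior)
  have approx: "\<exists>x. norm x < real n \<and> norm (L x - y) < e" if "norm (y - y0) < r" "e > 0" for y e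
  proof -
    have "y \<in> closure (L ` ball 0 (real n))"
      using r(2) that(1) by (auto simp: C_def dist_norm norm_minus_commute)
    then show ?thesis
      using that(2) by (fastforce simp: closure_approachable dist_norm)
  qed
  \<comment> \<open>The preimage built below has norm at most
    \<open>2 * real n / c = (4 * real n / r) * norm z\<close>; the summand 1 makes positivity
    immediate.\<close>
  define M where "M = 4 * real n / r + 1"
  show thesis
  proof (rule that[of M])
    show "M > 0" using r(1) by (simp add: M_def add_nonneg_pos)
    fix z
    show "\<exists>x. norm x \<le> M * norm z \<and> norm (z - L x) \<le> norm z / 2"
    proof (cases "z = 0")
      case True then show ?thesis by (intro exI[of _ 0]) simp
    next
      case False
      \<comment> \<open>\<open>c *\<^sub>R z\<close> has norm \<open>r / 2\<close>, so
        \<open>y0\<close> and \<open>y0 + c *\<^sub>R z\<close> both lie in the ball. The tolerance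
        \<open>r / 8\<close> at each of them adds up to \<open>r / 4\<close>, which division by
        \<open>c\<close> turns into \<open>norm z / 2\<close>.\<close>
      define c where "c = r / (2 * norm z)"
      have c: "c > 0" "norm (c *\<^sub>R z) < r" using False r(1) by (auto simp: c_def)
      obtain x1 where x1: "norm x1 < real n" "norm (L x1 - y0) < r / 8"
        using approx[of y0 "r / 8"] r(1) by auto
      obtain x2 where x2: "norm x2 < real n" "norm (L x2 - (y0 + c *\<^sub>R z)) < r / 8"
        using approx[of "y0 + c *\<^sub>R z" "r / 8"] r(1) c(2) by auto
      define x where "x = (1 / c) *\<^sub>R (x2 - x1)"
      have "norm (x2 - x1) \<le> 2 * real n" using norm_triangle_ineq4[of x2 x1] x1 x2 by linarith
      then have "norm x \<le> (1 / c) * (2 * real n)"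
        using c(1) by (simp add: x_def divide_right_mono)
      also have "\<dots> \<le> M * norm z" using False by (simp add: c_def M_def field_simps)
      finally have 1: "norm x \<le> M * norm z" .
      have "z - L x = (1 / c) *\<^sub>R ((L x1 - y0) - (L x2 - (y0 + c *\<^sub>R z)))"
        using c(1) by (simp add: x_def blinfun.bilinear_simps algebra_simps)
      moreover have "norm ((L x1 - y0) - (L x2 - (y0 + c *\<^sub>R z))) \<le> r / 4"
        using norm_triangle_ineq4[of "L x1 - y0" "L x2 - (y0 + c *\<^sub>R z)"] x1 x2 by linarith
      ultimately have "norm (z - L x) \<le> (1 / c) * (r / 4)"
        using c(1) mult_left_mono[of _ "r / 4" "1 / c"] by (simp only: norm_scaleR) simp
      also have "\<dots> = norm z / 2" using False r(1) by (simp add: c_def)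
      finally show ?thesis using 1 by blast
    qed
  qed
qed

text \<open>Successive approximation: each correction halves the residual, so the corrections are
  dominated by a geometric series and sum to an exact preimage because the domain is
  complete.\<close>

lemma surj_imp_bounded_preimage:
  fixes L :: "'a::banach \<Rightarrow>\<^sub>L 'b::banach"
  assumes "surj L"
  obtains K where "K > 0" "\<And>y. \<exists>x. L x = y \<and> norm x \<le> K * norm y"
proof -
  obtain M where M: "M > 0" "\<And>z. \<exists>x. norm x \<le> M * norm z \<and> norm (z - L x) \<le> norm z / 2"
    using surj_imp_almost_open[OF assms] by blast
  then obtain h where h: "\<And>z. norm (h z) \<le> M * norm z" "\<And>z. norm (z - L (h z)) \<le> norm z / 2"
    by metis
  show thesis
  proof (rule that[of "2 * M"])
    show "2 * M > 0" using M(1) by simp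
    fix y
    \<comment> \<open>The residual after \<open>n\<close> corrections. The images of the corrections
      are consecutive differences of residuals and therefore telescope to \<open>y\<close>.\<close>
    define z where "z n = ((\<lambda>z. z - L (h z)) ^^ n) y" for n
    have z0: "z 0 = y" and zS: "z (Suc n) = z n - L (h (z n))" for n
      by (simp_all add: z_def)
    have zb: "norm (z n) \<le> norm y * (1/2) ^ n" for n
    proof (induction n)
      case (Suc n)
      then show ?case using h(2)[of "z n"] by (simp add: zS)
    qed (simp add: z0)
    have hb: "norm (h (z n)) \<le> M * norm y * (1/2) ^ n" for n
      using order_trans[OF h(1) mult_left_mono[OF zb]] M(1) by (simp add: mult.assoc)
    have geo: "(\<lambda>n. M * norm y * (1/2) ^ n) sums (M * norm y * 2)"
      using sums_mult[OF geometric_sums[of "1/2::real"]] by simp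
    have sn: "summable (\<lambda>n. norm (h (z n)))"
      by (rule summable_comparison_test'[OF sums_summable[OF geo]]) (use hb in simp)
    then have sm: "summable (\<lambda>n. h (z n))" by (rule summable_norm_cancel)
    have "norm (\<Sum>n. h (z n)) \<le> (\<Sum>n. norm (h (z n)))" by (rule summable_norm[OF sn])
    also have "\<dots> \<le> 2 * M * norm y"
      using suminf_le[OF hb sn sums_summable[OF geo]] sums_unique[OF geo] by simp
    finally have bd: "norm (\<Sum>n. h (z n)) \<le> 2 * M * norm y" .
    have "(\<lambda>n. norm y * (1/2) ^ n) \<longlonglongrightarrow> 0"
      by (intro tendsto_mult_right_zero LIMSEQ_power_zero) simp
    then have "z \<longlonglongrightarrow> 0"
      by (rule Lim_null_comparison[rotated]) (simp add: zb)
    then have "(\<lambda>n. z n - z (Suc n)) sums (z 0 - 0)" by (rule telescope_sums')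
    then have "(\<lambda>n. L (h (z n))) sums y" by (simp add: zS z0)
    moreover have "(\<lambda>n. L (h (z n))) sums L (\<Sum>n. h (z n))"
      by (rule bounded_linear.sums[OF blinfun.bounded_linear_right summable_sums[OF sm]])
    ultimately have "L (\<Sum>n. h (z n)) = y" by (rule sums_unique2[symmetric])
    then show "\<exists>x. L x = y \<and> norm x \<le> 2 * M * norm y" using bd by blast
  qed
qed

text \<open>Since preimages are unique, the bound on some preimage is a bound on the
  inverse.\<close>

lemma bij_imp_invertible_op:
  fixes L :: "'a::banach \<Rightarrow>\<^sub>L 'b::banach"
  assumes "bij L"
  shows "invertible_op L"
proof -
  have inj: "inj L" and surj: "surj L" using assms by (auto simp: bij_def)
  obtain K where K: "\<And>y. \<exists>x. L x = y \<and> norm x \<le> K * norm y"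
    using surj_imp_bounded_preimage[OF surj] by blast
  have L1: "L (inv L y) = y" and L2: "inv L (L x) = x" for x y
    using surj inj by (simp_all add: surj_f_inv_f)
  have "bounded_linear (inv L)"
  proof (rule bounded_linear_intro)
    show "inv L (x + y) = inv L x + inv L y" for x y
      by (metis L1 L2 blinfun.add_right)
    show "inv L (r *\<^sub>R x) = r *\<^sub>R inv L x" for r x
      by (metis L1 L2 blinfun.scaleR_right)
    show "norm (inv L x) \<le> norm x * K" for x
      using K[of x] L2 by (metis mult.commute)
  qed
  then have "blinfun_apply (Blinfun (inv L)) = inv L" by (rule bounded_linear_Blinfun_apply)
  then show ?thesis
    unfolding invertible_op_def
    by (intro exI[of _ "Blinfun (inv L)"]) (auto intro!: blinfun_eqI simp: L1 L2)
qed

subsection \<open>Fredholm operators of index 0\<close>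

lemma subspace_range_space: "subspace (range_space L)"
  unfolding range_space_def
  by (rule linear_subspace_image) (simp_all add: bounded_linear.linear[OF blinfun.bounded_linear_right])

text \<open>The value 1 of \<open>dim\<close> cannot be its default 0, so it yields a genuine
  one-element basis, and \<open>v\<close> is a nonzero multiple of that element.\<close>

lemma dim_one_subset_span:
  fixes V :: "'a::real_vector set"
  assumes "dim V = 1" "v \<in> V" "v \<noteq> 0"
  shows "V \<subseteq> span {v}"
proof -
  obtain B where B: "B \<subseteq> V" "V \<subseteq> span B" "card B = 1"
    using basis_exists[of V] assms(1) by metis
  then obtain u where u: "V \<subseteq> span {u}" by (auto simp: card_1_singleton_iff)
  then obtain c where c: "v = c *\<^sub>R u" using assms(2) by (auto simp: span_singleton)
  then have "u = (1 / c) *\<^sub>R v" using assms(3) by auto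
  then have "u \<in> span {v}" by (metis span_base span_scale singletonI)
  then have "span {u} \<subseteq> span {v}" by (simp add: span_minimal)
  then show ?thesis using u by blast
qed

lemma finite_dim_span: "finite B \<Longrightarrow> finite_dim (span B)"
  by (auto simp: finite_dim_def)

text \<open>Finite dimension keeps \<open>dim\<close> away from its default value 0 on
  infinite-dimensional sets.\<close>

lemma dim_pos_if_nonzero:
  assumes "finite_dim V" "v \<in> V" "v \<noteq> 0"
  shows "dim V > 0"
proof -
  obtain B where B: "B \<subseteq> V" "independent B" "V \<subseteq> span B" "card B = dim V"
    using basis_exists by blast
  obtain S where S: "finite S" "span S = V" using assms(1) by (auto simp: finite_dim_def)
  have "finite B" using independent_span_bound[OF S(1) B(2)] S(2) B(1) by simp
  moreover have "B \<noteq> {}" using B(3) assms(2,3) by auto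
  ultimately show ?thesis using B(4) by (simp add: card_gt_0_iff flip: B(4))
qed

locale fredholm_index_0 =
  fixes L :: "'a::banach \<Rightarrow>\<^sub>L 'b::banach"
  assumes fredholm: "fredholm_op L" and index_0: "fredholm_index L = 0"
begin

lemma dim_null_space_eq:
  assumes "algebraic_complement (range_space L) C" "finite_dim C"
  shows "dim (null_space L) = dim C"
  using codim_eq_dim_complement[OF subspace_range_space assms] index_0
  by (simp add: fredholm_index_def)

lemma complement_exists:
  obtains C where "algebraic_complement (range_space L) C" "finite_dim C"
    "dim (null_space L) = dim C"
  using fredholm dim_null_space_eq by (auto simp: fredholm_op_def finite_codim_def)

text \<open>With index 0, a trivial kernel forces a trivial complement of the range. The operator is
  then bijective, hence invertible by the open mapping theorem.\<close>

lemma not_invertible_imp_kernel: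
  assumes "\<not> invertible_op L"
  obtains v where "v \<noteq> 0" "L v = 0"
proof (rule ccontr)
  assume "\<not> thesis"
  then have triv: "\<And>v. L v = 0 \<Longrightarrow> v = 0" using that by blast
  then have "inj L"
    by (simp add: linear_injective_0[OF bounded_linear.linear[OF blinfun.bounded_linear_right]])
  have "null_space L \<subseteq> span {}" using triv by (auto simp: null_space_def)
  then have "dim (null_space L) = 0" using dim_le_card[of "null_space L" "{}"] by simp
  moreover obtain C where C: "algebraic_complement (range_space L) C" "finite_dim C"
    "dim (null_space L) = dim C" using complement_exists by blast
  ultimately have "\<And>c. c \<in> C \<Longrightarrow> c = 0" using dim_pos_if_nonzero[OF C(2)] by force
  then have "surj L"
    using C(1) unfolding algebraic_complement_def range_space_def surj_def
    by (metis add.right_neutral imageE)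
  with \<open>inj L\<close> have "invertible_op L" by (intro bij_imp_invertible_op bijI)
  then show False using assms by contradiction
qed

text \<open>Index 0 makes the complement of the range a line, and the functional is the coordinate
  along that line. Its boundedness comes from the open mapping theorem for \<open>P\<close>
  below.\<close>

lemma range_eq_kernel_of_functional:
  assumes "dim (null_space L) = 1"
  obtains l :: "'b \<Rightarrow>\<^sub>L real" where "l \<noteq> 0" "null_space l = range_space L"
proof -
  obtain C where C: "algebraic_complement (range_space L) C" "finite_dim C"
    "dim C = 1" using complement_exists assms by metis
  have sC: "subspace C" and RC: "range_space L \<inter> C = {0}"
    and dec: "\<And>y. \<exists>w\<in>range_space L. \<exists>c\<in>C. y = w + c"
    using C(1) by (auto simp: algebraic_complement_def)
  obtain c where c: "c \<in> C" "c \<noteq> 0"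
  proof -
    have "\<not> C \<subseteq> span {}" using dim_le_card[of C "{}"] C(3) by auto
    then show ?thesis using that by auto
  qed
  have Cc: "C \<subseteq> span {c}" using dim_one_subset_span[OF C(3) c] .
  \<comment> \<open>\<open>P\<close> is onto but not injective, as \<open>L\<close> has a kernel.
    Still, \<open>s\<close> is determined by the value, and a bounded preimage under
    \<open>P\<close> bounds it.\<close>
  define P where "P = Blinfun (\<lambda>(x, s). L x + s *\<^sub>R c)"
  have P: "P (x, s) = L x + s *\<^sub>R c" for x s
    unfolding P_def
    by (subst bounded_linear_Blinfun_apply)
      (auto simp: case_prod_unfold intro!: bounded_linear_intros)
  have sP: "\<exists>x s. y = L x + s *\<^sub>R c" for y
    using dec[of y] Cc by (fastforce simp: range_space_def span_singleton)
  then have "surj P" unfolding surj_def by (metis P)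
  then obtain K where K: "\<And>y. \<exists>p. P p = y \<and> norm p \<le> K * norm y"
    using surj_imp_bounded_preimage by blast
  have uniq: "s = s'" if "L x + s *\<^sub>R c = L x' + s' *\<^sub>R c" for x x' s s'
  proof -
    have "(s' - s) *\<^sub>R c = L (x - x')" using that by (simp add: blinfun.diff_right algebra_simps)
    then have "(s' - s) *\<^sub>R c \<in> range_space L" by (simp add: range_space_def)
    then have "(s' - s) *\<^sub>R c \<in> {0}" using RC subspace_scale[OF sC c(1)] by blast
    then show ?thesis using c(2) by simp
  qed
  define l where "l y = (THE s. \<exists>x. y = L x + s *\<^sub>R c)" for y
  have l: "l (L x + s *\<^sub>R c) = s" for x s
    unfolding l_def by (rule the_equality) (use uniq in blast)+
  have bl: "bounded_linear l"
  proof (rule bounded_linear_intro)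
    show "l (y + y') = l y + l y'" for y y'
    proof -
      obtain x s x' s' where "y = L x + s *\<^sub>R c" "y' = L x' + s' *\<^sub>R c" using sP by metis
      moreover from this have "y + y' = L (x + x') + (s + s') *\<^sub>R c"
        by (simp add: blinfun.add_right algebra_simps)
      ultimately show ?thesis by (simp only: l)
    qed
    show "l (r *\<^sub>R y) = r *\<^sub>R l y" for r y
    proof -
      obtain x s where "y = L x + s *\<^sub>R c" using sP by metis
      moreover from this have "r *\<^sub>R y = L (r *\<^sub>R x) + (r * s) *\<^sub>R c"
        by (simp add: blinfun.scaleR_right algebra_simps)
      ultimately show ?thesis by (simp only: l real_scaleR_def)
    qed
    show "norm (l y) \<le> norm y * K" for y
    proof -
      obtain x s where "P (x, s) = y" "norm (x, s) \<le> K * norm y" using K[of y] by auto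
      then have "l y = s" "norm s \<le> norm y * K"
        using l[of x s] norm_snd_le[of s x] by (auto simp: P mult.commute)
      then show ?thesis by simp
    qed
  qed
  show thesis
  proof (rule that[of "Blinfun l"])
    have "l c = 1" using l[of 0 1] by simp
    then show "Blinfun l \<noteq> 0"
      by (metis bl bounded_linear_Blinfun_apply zero_blinfun.rep_eq zero_neq_one)
    have "l y = 0 \<longleftrightarrow> y \<in> range_space L" for y
    proof -
      obtain x s where y: "y = L x + s *\<^sub>R c" using sP by metis
      have "y \<in> range_space L" if "s = 0" using y that by (simp add: range_space_def)
      moreover have "l y = 0" if yR: "y \<in> range_space L"
      proof -
        obtain x' where "y = L x' + 0 *\<^sub>R c" using yR by (auto simp: range_space_def)
        then show ?thesis by (simp only: l)
      qed
      moreover have "l y = s" using y by (simp only: l)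
      ultimately show ?thesis by auto
    qed
    then show "null_space (Blinfun l) = range_space L"
      by (auto simp: null_space_def bounded_linear_Blinfun_apply[OF bl])
  qed
qed

text \<open>The range together with \<open>b\<close> fills the space, so the codimension, and with
  it the kernel dimension, is at most 1; \<open>v\<close> makes it at least 1.\<close>

lemma dim_null_space_eq_1:
  assumes "L v = 0" "v \<noteq> 0" and onto: "\<And>y. \<exists>x s. y = L x + s *\<^sub>R b"
  shows "dim (null_space L) = 1"
proof -
  have pos: "dim (null_space L) > 0"
    using dim_pos_if_nonzero[of "null_space L" v] fredholm assms(1,2)
    by (auto simp: fredholm_op_def null_space_def)
  have "b \<notin> range_space L"
  proof
    \<comment> \<open>Then \<open>L\<close> would be onto, and index 0 would make its kernel
      trivial, against \<open>v\<close>.\<close>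
    assume b: "b \<in> range_space L"
    have "y \<in> range_space L" for y
      using onto[of y] b subspace_range_space[of L]
      by (auto intro!: subspace_add subspace_scale simp: range_space_def)
    then have "range_space L = UNIV" by blast
    then have "algebraic_complement (range_space L) (span {})"
      by (auto simp: algebraic_complement_def subspace_0)
    then have "dim (null_space L) = dim (span {} :: 'b set)"
      by (rule dim_null_space_eq) (rule finite_dim_span, simp)
    then show False using pos dim_le_card[of "span {} :: 'b set" "{}"] by simp
  qed
  then have bR: "s = 0" if "s *\<^sub>R b \<in> range_space L" for s
    using that subspace_scale[OF subspace_range_space that, of "1 / s"] by (cases "s = 0") auto
  have "algebraic_complement (range_space L) (span {b})"
    unfolding algebraic_complement_def
  proof (intro conjI allI)
    show "subspace (span {b})" by simp
    show "range_space L \<inter> span {b} = {0}"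
      using bR subspace_0[OF subspace_range_space[of L]] by (auto simp: span_singleton)
    fix y show "\<exists>w\<in>range_space L. \<exists>c\<in>span {b}. y = w + c"
      using onto[of y] by (fastforce simp: span_singleton range_space_def)
  qed
  then have "dim (null_space L) = dim (span {b})"
    by (rule dim_null_space_eq) (rule finite_dim_span, simp)
  also have "\<dots> \<le> 1" using dim_le_card[of "span {b}" "{b}"] by simp
  finally show ?thesis using pos by simp
qed

section \<open>Transversality and surjectivity for a single operator of index 0\<close>

lemma null_space_adjoint_iff:
  "l \<in> null_space (adjoint_op L) \<longleftrightarrow> (\<forall>x. l (L x) = 0)"
  by (auto simp: null_space_def adjoint_op.rep_eq blinfun_eqI simp flip: blinfun_apply_blinfun_compose)

text \<open>A functional \<open>l\<close> with kernel the range of \<open>L\<close> reduces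
  solvability to two scalar equations. The system is triangular: \<tau> settles the first component,
  and a multiple of \<open>v\<close> added to \<xi> settles the second without disturbing the
  first.\<close>

lemma surj_if_transversal:
  assumes "L v = 0" and A: "linear A"
    and T1: "dim (null_space L) = 1"
    and T2: "\<And>l :: 'b \<Rightarrow>\<^sub>L real. \<lbrakk>l \<noteq> 0; l \<in> null_space (adjoint_op L)\<rbrakk> \<Longrightarrow> l b \<noteq> 0"
    and T3: "\<And>l :: 'b \<Rightarrow>\<^sub>L real. \<lbrakk>l \<noteq> 0; l \<in> null_space (adjoint_op L)\<rbrakk> \<Longrightarrow> l (A (v, 0)) \<noteq> 0"
  shows "surj (\<lambda>(\<xi>, \<tau>, w). (L \<xi> + \<tau> *\<^sub>R b, A (\<xi>, \<tau> :: real) + L w))"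
proof -
  obtain l :: "'b \<Rightarrow>\<^sub>L real" where l: "l \<noteq> 0" "null_space l = range_space L"
    using range_eq_kernel_of_functional[OF T1] by blast
  then have lR: "\<And>y. l y = 0 \<longleftrightarrow> (\<exists>x. y = L x)"
    by (auto simp: null_space_def range_space_def)
  have "l \<in> null_space (adjoint_op L)" using lR by (auto simp: null_space_adjoint_iff)
  note lb = T2[OF l(1) this] and la = T3[OF l(1) this]
  have "\<exists>\<xi> \<tau> w. (y, z) = (L \<xi> + \<tau> *\<^sub>R b, A (\<xi>, \<tau>) + L w)" for y z
  proof -
    \<comment> \<open>The only value for which \<open>y - \<tau> *\<^sub>R b\<close> lies in the
      range of \<open>L\<close>.\<close>
    define \<tau> where "\<tau> = l y / l b"
    have "l (y - \<tau> *\<^sub>R b) = 0" using lb by (simp add: \<tau>_def blinfun.bilinear_simps)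
    then obtain \<eta> where \<eta>: "y - \<tau> *\<^sub>R b = L \<eta>" using lR by blast
    \<comment> \<open>Chosen so that \<open>l\<close> vanishes on what \<open>L w\<close> still has
      to supply after \<eta> is shifted by \<open>s *\<^sub>R v\<close>.\<close>
    define s where "s = l (z - A (\<eta>, \<tau>)) / l (A (v, 0))"
    have "l (z - A (\<eta>, \<tau>) - s *\<^sub>R A (v, 0)) = 0"
      using la by (simp add: s_def blinfun.bilinear_simps)
    then obtain w where w: "z - A (\<eta>, \<tau>) - s *\<^sub>R A (v, 0) = L w" using lR by blast
    have "A (\<eta> + s *\<^sub>R v, \<tau>) = A (\<eta>, \<tau>) + s *\<^sub>R A (v, 0)"
      using linear_add[OF A, of "(\<eta>, \<tau>)" "s *\<^sub>R (v, 0)"] linear_scale[OF A, of s "(v, 0)"] by simp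
    moreover have "L (\<eta> + s *\<^sub>R v) = L \<eta>" using assms(1) by (simp add: blinfun.bilinear_simps)
    ultimately have "(y, z) = (L (\<eta> + s *\<^sub>R v) + \<tau> *\<^sub>R b, A (\<eta> + s *\<^sub>R v, \<tau>) + L w)"
      using \<eta> w by (simp add: algebra_simps)
    then show ?thesis by blast
  qed
  then show ?thesis by (simp add: surj_def case_prod_unfold)
qed

text \<open>Test surjectivity on suitable targets and apply \<open>l\<close>, which annihilates the
  range of \<open>L\<close>: the target \<open>(y, 0)\<close> with \<open>l y \<noteq> 0\<close>
  gives the second claim, the target \<open>(0, y)\<close> the third.\<close>

lemma transversal_if_surj:
  assumes v: "L v = 0" "v \<noteq> 0" and A: "linear A"
    and surj: "surj (\<lambda>(\<xi>, \<tau>, w). (L \<xi> + \<tau> *\<^sub>R b, A (\<xi>, \<tau> :: real) + L w))"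
  shows "dim (null_space L) = 1"
    and "\<And>l :: 'b \<Rightarrow>\<^sub>L real. \<lbrakk>l \<noteq> 0; l \<in> null_space (adjoint_op L)\<rbrakk> \<Longrightarrow> l b \<noteq> 0"
    and "\<And>l :: 'b \<Rightarrow>\<^sub>L real. \<lbrakk>l \<noteq> 0; l \<in> null_space (adjoint_op L)\<rbrakk> \<Longrightarrow> l (A (v, 0)) \<noteq> 0"
proof -
  have onto: "\<exists>\<xi> \<tau> w. y = L \<xi> + \<tau> *\<^sub>R b \<and> z = A (\<xi>, \<tau>) + L w" for y z
    using surjD[OF surj, of "(y, z)"] by auto
  show T1: "dim (null_space L) = 1"
    using dim_null_space_eq_1[OF v] onto by blast
  fix l :: "'b \<Rightarrow>\<^sub>L real"
  assume l: "l \<noteq> 0" "l \<in> null_space (adjoint_op L)"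
  then have lR: "l (L x) = 0" for x by (simp add: null_space_adjoint_iff)
  obtain y where y: "l y \<noteq> 0" using l(1) by (metis blinfun_eqI zero_blinfun.rep_eq)
  show lb: "l b \<noteq> 0"
    using onto[of y 0] y lR by (auto simp: blinfun.bilinear_simps)
  \<comment> \<open>The zero first component forces \<tau> = 0 and puts \<xi> into the kernel, which
    is the line through \<open>v\<close>; so \<open>l y\<close> is a multiple of
    \<open>l (A (v, 0))\<close>.\<close>
  obtain \<xi> \<tau> w where eq: "0 = L \<xi> + \<tau> *\<^sub>R b" "y = A (\<xi>, \<tau>) + L w" using onto by blast
  have "l (L \<xi> + \<tau> *\<^sub>R b) = 0" using eq(1) by (metis blinfun.zero_right)
  then have \<tau>: "\<tau> = 0" using lb lR by (simp add: blinfun.bilinear_simps)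
  then have "\<xi> \<in> null_space L" using eq(1) by (simp add: null_space_def)
  then obtain s where "\<xi> = s *\<^sub>R v"
    using dim_one_subset_span[OF T1, of v] v by (auto simp: null_space_def span_singleton)
  then have "A (\<xi>, \<tau>) = s *\<^sub>R A (v, 0)" using \<tau> linear_scale[OF A, of s "(v, 0)"] by simp
  then have "l y = s * l (A (v, 0))" using eq(2) lR by (simp add: blinfun.bilinear_simps)
  then show "l (A (v, 0)) \<noteq> 0" using y by auto
qed

end

subsection \<open>Partial differentials\<close>

lemma C1_on_has_derivative:
  assumes "C1_on U F" "p \<in> U"
  shows "(F has_derivative differential F p) (at p)"
proof -
  have "(F has_derivative frechet_derivative F (at p)) (at p)"
    using assms by (simp add: C1_on_def frechet_derivative_works)
  moreover from this have "blinfun_apply (differential F p) = frechet_derivative F (at p)"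
    unfolding differential_def by (intro bounded_linear_Blinfun_apply has_derivative_bounded_linear)
  ultimately show ?thesis by simp
qed

text \<open>Composing a total differential with this embedding restricts it to the space directions.
  As a bounded linear operation on operators, this restriction commutes with
  differentiation.\<close>

definition inl_blinfun :: "'a::real_normed_vector \<Rightarrow>\<^sub>L ('a \<times> real)" where
  "inl_blinfun = Blinfun (\<lambda>x. (x, 0))"

lemma inl_blinfun_apply [simp]: "inl_blinfun x = (x, 0)"
  unfolding inl_blinfun_def
  by (subst bounded_linear_Blinfun_apply) (auto intro!: bounded_linear_intros)

lemma Dx_eq:
  assumes "C1_on U f" "(x, t) \<in> U"
  shows "Dx f x t = differential f (x, t) o\<^sub>L inl_blinfun"
  unfolding Dx_def
proof (rule differential_eq)
  have "((\<lambda>x. (x, t)) has_derivative inl_blinfun) (at x)"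
    by (auto intro!: derivative_eq_intros)
  from diff_chain_at[OF this C1_on_has_derivative[OF assms]]
  show "((\<lambda>x. f (x, t)) has_derivative differential f (x, t) o\<^sub>L inl_blinfun) (at x)"
    by (simp add: blinfun_compose.rep_eq o_def)
qed

lemma Dt_eq:
  assumes "C1_on U f" "(x, t) \<in> U"
  shows "Dt f x t = differential f (x, t) (0, 1)"
  unfolding Dt_def
proof (rule vector_derivative_at)
  have "(Pair x has_derivative (\<lambda>s. (0, s))) (at t)"
    by (auto intro!: derivative_eq_intros)
  from diff_chain_at[OF this C1_on_has_derivative[OF assms]]
  have "((\<lambda>t. f (x, t)) has_derivative (\<lambda>s. differential f (x, t) (s *\<^sub>R (0, 1)))) (at t)"
    by (simp add: o_def)
  then show "((\<lambda>t. f (x, t)) has_vector_derivative differential f (x, t) (0, 1)) (at t)"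
    by (simp only: has_vector_derivative_def blinfun.scaleR_right)
qed

lemma Dxx_eq:
  assumes "C2_on U f" "(x, t) \<in> U"
  shows "Dxx f x t v w = differential (differential f) (x, t) (v, 0) (w, 0)"
proof -
  let ?D = "differential f"
  have C1: "C1_on U f" "C1_on U ?D" and U: "open U" using assms(1) by (auto simp: C2_on_def C1_on_def)
  have "((\<lambda>y. (y, t)) has_derivative (\<lambda>v. (v, 0))) (at x)"
    by (auto intro!: derivative_eq_intros)
  from diff_chain_at[OF this C1_on_has_derivative[OF C1(2) assms(2)]]
  have "((\<lambda>y. ?D (y, t)) has_derivative (\<lambda>v. differential ?D (x, t) (v, 0))) (at x)"
    by (simp add: o_def)
  then have der: "((\<lambda>y. ?D (y, t) o\<^sub>L inl_blinfun) has_derivative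
      (\<lambda>v. differential ?D (x, t) (v, 0) o\<^sub>L inl_blinfun)) (at x)"
    by (rule bounded_linear.has_derivative
        [OF bounded_bilinear.bounded_linear_left[OF bounded_bilinear_blinfun_compose]])
  \<comment> \<open>\<open>Dx\<close> is known to be the restricted total differential only over
    \<open>U\<close>; an open slice is enough to transfer the derivative at
    \<open>x\<close>.\<close>
  have "open ((\<lambda>y. (y, t)) -` U)"
    by (rule open_vimage[OF U]) (intro continuous_intros)
  then have der': "((\<lambda>y. Dx f y t) has_derivative
      (\<lambda>v. differential ?D (x, t) (v, 0) o\<^sub>L inl_blinfun)) (at x)"
    by (rule has_derivative_transform_within_open[OF der]) (use assms Dx_eq[OF C1(1)] in auto)
  then have "Dxx f x t = Blinfun (\<lambda>v. differential ?D (x, t) (v, 0) o\<^sub>L inl_blinfun)"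
    unfolding Dxx_def
    by (intro differential_eq)
      (simp add: bounded_linear_Blinfun_apply has_derivative_bounded_linear[OF der'])
  then show ?thesis
    by (simp add: bounded_linear_Blinfun_apply has_derivative_bounded_linear[OF der'])
qed

text \<open>Over \<open>V\<close> the second component is the total differential of \<open>f\<close>
  applied to \<open>(w, 0)\<close>, so the product rule for evaluating an operator at a vector
  applies.\<close>

lemma differential_augmented_map:
  assumes f: "C2_on U f" "(x, t) \<in> U" and V: "open V" "(x, t, v) \<in> V"
    and VU: "\<And>y s w. (y, s, w) \<in> V \<Longrightarrow> (y, s) \<in> U"
    and g: "\<And>y s w. (y, s, w) \<in> V \<Longrightarrow> g (y, s, w) = (f (y, s), Dx f y s w)"
  shows "blinfun_apply (differential g (x, t, v)) = (\<lambda>(\<xi>, \<tau>, w). (Dx f x t \<xi> + \<tau> *\<^sub>R Dt f x t,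
      differential (differential f) (x, t) (\<xi>, \<tau>) (v, 0) + Dx f x t w))"
proof -
  let ?D = "differential f"
  let ?d = "\<lambda>(\<xi>, \<tau>, w). (Dx f x t \<xi> + \<tau> *\<^sub>R Dt f x t,
      differential ?D (x, t) (\<xi>, \<tau>) (v, 0) + Dx f x t w)"
  have C1: "C1_on U f" "C1_on U ?D" using f(1) by (auto simp: C2_on_def)
  have pr: "((\<lambda>q. (fst q, fst (snd q))) has_derivative (\<lambda>h. (fst h, fst (snd h)))) (at (x, t, v))"
    by (auto intro!: derivative_eq_intros)
  have 1: "((\<lambda>q. f (fst q, fst (snd q))) has_derivative
      (\<lambda>h. ?D (x, t) (fst h, fst (snd h)))) (at (x, t, v))"
    using diff_chain_at[OF pr, of f "?D (x, t)"] C1_on_has_derivative[OF C1(1) f(2)]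
    by (simp add: o_def)
  have 2: "((\<lambda>q. ?D (fst q, fst (snd q))) has_derivative
      (\<lambda>h. differential ?D (x, t) (fst h, fst (snd h)))) (at (x, t, v))"
    using diff_chain_at[OF pr, of ?D "differential ?D (x, t)"] C1_on_has_derivative[OF C1(2) f(2)]
    by (simp add: o_def)
  have 3: "((\<lambda>q. (snd (snd q), 0::real)) has_derivative (\<lambda>h. (snd (snd h), 0))) (at (x, t, v))"
    by (auto intro!: derivative_eq_intros)
  have "((\<lambda>q. (f (fst q, fst (snd q)), ?D (fst q, fst (snd q)) (snd (snd q), 0))) has_derivative
      (\<lambda>h. (?D (x, t) (fst h, fst (snd h)), ?D (x, t) (snd (snd h), 0) +
        differential ?D (x, t) (fst h, fst (snd h)) (v, 0)))) (at (x, t, v))"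
    using has_derivative_Pair[OF 1 blinfun.FDERIV[OF 2 3]] by simp
  \<comment> \<open>Splitting \<open>(\<xi>, \<tau>)\<close> as
    \<open>(\<xi>, 0) + \<tau> *\<^sub>R (0, 1)\<close> turns the total differential into the
    partial ones.\<close>
  also have "(\<lambda>h. (?D (x, t) (fst h, fst (snd h)), ?D (x, t) (snd (snd h), 0) +
        differential ?D (x, t) (fst h, fst (snd h)) (v, 0))) = ?d"
    by (auto simp: fun_eq_iff Dx_eq[OF C1(1) f(2)] Dt_eq[OF C1(1) f(2)] add.commute
        simp flip: blinfun.add_right blinfun.scaleR_right)
  finally have der: "(g has_derivative ?d) (at (x, t, v))"
  proof (rule has_derivative_transform_within_open[OF _ V])
    fix q assume "q \<in> V"
    then show "(f (fst q, fst (snd q)), ?D (fst q, fst (snd q)) (snd (snd q), 0)) = g q"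
      using g[of "fst q" "fst (snd q)" "snd (snd q)"] VU[of "fst q" "fst (snd q)" "snd (snd q)"]
      by (simp add: Dx_eq[OF C1(1)])
  qed
  note eq = bounded_linear_Blinfun_apply[OF has_derivative_bounded_linear[OF der]]
  show ?thesis
    using differential_eq[of g "Blinfun ?d"] der eq by simp
qed

section \<open>Transfer of the operator statements to \<open>f\<close> and \<open>g\<close>\<close>

theorem lemma2p8:
  fixes X :: "'a::banach set"
    and T :: real
    and f :: "'a \<times> real \<Rightarrow> 'b::banach"
    and \<Sigma> :: "('a \<times> real \<times> 'a) set"
    and g :: "'a \<times> real \<times> 'a \<Rightarrow> 'b \<times> 'b"
  assumes "T > 0"
    and "open X" and "connected X"
    and "C2_on (X \<times> {0<..<T}) f"
    and "\<And>t. t \<in> {0<..<T} \<Longrightarrow> fredholm_map 0 X (\<lambda>x. f (x, t))"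
    and "\<Sigma> = X \<times> {0<..<T} \<times> (UNIV - {0})"
    and "\<And>x t v. (x, t, v) \<in> \<Sigma> \<Longrightarrow> g (x, t, v) = (f (x, t), blinfun_apply (Dx f x t) v)"
  shows "transversality_conditions X T f \<longleftrightarrow> regular_value_on \<Sigma> g (0, 0)"
proof -
  note f = \<open>C2_on (X \<times> {0<..<T}) f\<close>
  define A where "A x t v p = differential (differential f) (x, t) p (v, 0)" for x t v p
  have lin: "linear (A x t v)" for x t v
    unfolding A_def by (intro linearI) (simp_all add: blinfun.bilinear_simps)
  have A_Dxx: "A x t v (v, 0) = Dxx f x t v v" if "x \<in> X" "t \<in> {0<..<T}" for x t v
    using that Dxx_eq[OF f] by (simp add: A_def)
  have fred: "fredholm_index_0 (Dx f x t)" if "x \<in> X" "t \<in> {0<..<T}" for x t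
    using assms(5)[OF that(2)] that(1) unfolding fredholm_map_def Dx_def by unfold_locales auto
  have op: "open \<Sigma>" unfolding assms(6) using assms(2) by (intro open_Times open_delete) auto
  have dg: "blinfun_apply (differential g (x, t, v)) = (\<lambda>(\<xi>, \<tau>, w). (Dx f x t \<xi> + \<tau> *\<^sub>R Dt f x t,
      A x t v (\<xi>, \<tau>) + Dx f x t w))" if "(x, t, v) \<in> \<Sigma>" for x t v
    unfolding A_def
    by (rule differential_augmented_map[OF f _ op that]) (use that assms(6,7) in auto)
  show ?thesis
  proof
    assume tr: "transversality_conditions X T f"
    show "regular_value_on \<Sigma> g (0, 0)"
      unfolding regular_value_on_def
    proof clarify
      fix x t v assume p: "(x, t, v) \<in> \<Sigma>" and "g (x, t, v) = (0, 0)"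
      then have z: "f (x, t) = 0" "Dx f x t v = 0" using assms(7) by auto
      have xt: "x \<in> X" "t \<in> {0<..<T}" and v: "v \<noteq> 0" using p assms(6) by auto
      interpret fredholm_index_0 "Dx f x t" using fred[OF xt] .
      \<comment> \<open>A zero of \<open>g\<close> carries a nonzero kernel vector and so lies over
        the singular set.\<close>
      have "\<not> invertible_op (Dx f x t)"
      proof
        assume "invertible_op (Dx f x t)"
        then obtain M where "M o\<^sub>L Dx f x t = id_blinfun" by (auto simp: invertible_op_def)
        then have "M (Dx f x t v) = v" by (metis blinfun_apply_blinfun_compose blinfun_apply_id_blinfun)
        then show False using z v by simp
      qed
      then have "(x, t) \<in> singular_set X T f" using xt z by (simp add: singular_set_def)
      then have T: "T1_cond f x t" "T2_cond f x t" "T3_cond f x t"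
        using tr by (auto simp: transversality_conditions_def)
      show "surj (differential g (x, t, v))"
        unfolding dg[OF p]
      proof (rule surj_if_transversal[OF z(2) lin])
        show "dim (null_space (Dx f x t)) = 1" using T(1) by (simp add: T1_cond_def)
        fix l :: "'b \<Rightarrow>\<^sub>L real" assume l: "l \<noteq> 0" "l \<in> null_space (adjoint_op (Dx f x t))"
        show "l (Dt f x t) \<noteq> 0" using T(2) l by (simp add: T2_cond_def)
        show "l (A x t v (v, 0)) \<noteq> 0"
          using T(3) l z v by (simp add: T3_cond_def A_Dxx[OF xt] null_space_def)
      qed
    qed
  next
    assume reg: "regular_value_on \<Sigma> g (0, 0)"
    show "transversality_conditions X T f"
      unfolding transversality_conditions_def
    proof clarify
      fix x t assume "(x, t) \<in> singular_set X T f"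
      then have xt: "x \<in> X" "t \<in> {0<..<T}" and z: "f (x, t) = 0"
        and ninv: "\<not> invertible_op (Dx f x t)" by (auto simp: singular_set_def)
      interpret fredholm_index_0 "Dx f x t" using fred[OF xt] .
      \<comment> \<open>Every nonzero kernel vector over a singular point gives a zero of
        \<open>g\<close>. One such vector suffices for (T1) and (T2), whereas (T3) uses each of them
        in turn.\<close>
      have surj: "surj (\<lambda>(\<xi>, \<tau>, w). (Dx f x t \<xi> + \<tau> *\<^sub>R Dt f x t, A x t v (\<xi>, \<tau>) + Dx f x t w))"
        if "Dx f x t v = 0" "v \<noteq> 0" for v
      proof -
        have p: "(x, t, v) \<in> \<Sigma>" using xt that assms(6) by simp
        then have "g (x, t, v) = (0, 0)" using assms(7) z that by simp
        then show ?thesis using reg p dg[OF p] by (metis regular_value_on_def)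
      qed
      note tr = transversal_if_surj[OF _ _ lin surj]
      obtain v where v: "v \<noteq> 0" "Dx f x t v = 0" using not_invertible_imp_kernel[OF ninv] by blast
      have "T1_cond f x t" using tr(1) v by (simp add: T1_cond_def)
      moreover have "T2_cond f x t" using tr(2) v by (auto simp: T2_cond_def)
      moreover have "T3_cond f x t"
        unfolding T3_cond_def
      proof (intro allI impI, elim conjE)
        fix u l
        assume "u \<noteq> 0" "u \<in> null_space (Dx f x t)" "l \<noteq> 0" "l \<in> null_space (adjoint_op (Dx f x t))"
        then have "l (A x t u (u, 0)) \<noteq> 0" by (intro tr(3)) (auto simp: null_space_def)
        then show "l (Dxx f x t u u) \<noteq> 0" by (simp add: A_Dxx[OF xt])
      qed
      ultimately show "T1_cond f x t \<and> T2_cond f x t \<and> T3_cond f x t" by blast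
    qed
  qed
qed

end
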